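(* Let $B=(b_1,\dots,b_L)$ be a sequence of integers $b_i\ge 2$. Suppose the QKD source is ideal, i.e. it produces a stream of mutually independent bits, each uniformly distributed on $\{0,1\}$. Let the key $K$ be extracted from this stream by the key-extraction algorithm for $B$, and let the message $M$ be encrypted under $K$ by the MR-OTP with base sequence $B$, giving ciphertext $C$. Then this composition achieves perfect secrecy in the sense of Shannon: for every message distribution $\Pr[M]$ and every ciphertext $c$ with $\Pr[C=c]>0$, $$\Pr[M=m\mid C=c]=\Pr[M=m]\qquad\text{for all } m.$$
   Context: Key-extraction algorithm for $B$: let $P=\prod_{i=1}^L b_i$ and $k=\lceil\log_2 P\rceil$. Repeatedly read $k$ fresh bits from the source and interpret them as an integer $V$, until $V<P$. Then for $i=L,\dots,1$ set $k_i=V\bmod b_i$ and $V\leftarrow\lfloor V/b_i\rfloor$. Return $K=(k_1,\dots,k_L)$. MR-OTP (Mixed-Radix One-Time Pad) with base sequence $B$: messages, keys and ciphertexts are tuples in $\prod_{i=1}^L\{0,\dots,b_i-1\}$, and the message $m$ is encrypted under the key $K$ as $c_i=(m_i+k_i)\bmod b_i$ for each $i$. The random message $M$ is independent of the source bits (hence of $K$). *)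

theory Defs
  imports "HOL-Probability.Probability" "HOL-Library.While_Combinator"
begin

text \<open>Base sequences and tuples are lists, so the \<open>i\<close>-th component (counted from 1) is at
  list position \<open>i - 1\<close>.\<close>

definition mr_tuples :: "nat list \<Rightarrow> nat list set" where
  "mr_tuples bs = {xs. length xs = length bs \<and> (\<forall>i<length bs. xs ! i < bs ! i)}"

definition ideal_source :: "'a measure \<Rightarrow> ('a \<Rightarrow> bool stream) \<Rightarrow> bool" where
  "ideal_source \<Omega> S \<longleftrightarrow>
     prob_space.indep_vars \<Omega> (\<lambda>_. count_space UNIV) (\<lambda>n \<omega>. S \<omega> !! n) (UNIV :: nat set) \<and>
     (\<forall>n. distr \<Omega> (count_space UNIV) (\<lambda>\<omega>. S \<omega> !! n) = uniform_count_measure UNIV)"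

text \<open>Counterpart of \<open>prob_space.indep_var\<close> for two random variables with values in different
  types, which the library constant does not admit; cf. \<open>prob_space.indep_var_eq\<close>.\<close>

definition indep_rvs ::
  "'a measure \<Rightarrow> 'b measure \<Rightarrow> ('a \<Rightarrow> 'b) \<Rightarrow> 'c measure \<Rightarrow> ('a \<Rightarrow> 'c) \<Rightarrow> bool" where
  "indep_rvs \<Omega> N X N' Y \<longleftrightarrow>
     X \<in> measurable \<Omega> N \<and> Y \<in> measurable \<Omega> N' \<and>
     prob_space.indep_set \<Omega>
       (sigma_sets (space \<Omega>) {X -` A \<inter> space \<Omega> | A. A \<in> sets N})
       (sigma_sets (space \<Omega>) {Y -` A \<inter> space \<Omega> | A. A \<in> sets N'})"

text \<open>The first bit read is the most significant one. The second component of the result is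
  the unread rest of the stream.\<close>

definition read_block :: "nat \<Rightarrow> bool stream \<Rightarrow> nat \<times> bool stream" where
  "read_block k s = (horner_sum of_bool 2 (rev (stake k s)), sdrop k s)"

text \<open>The result is \<open>None\<close> exactly if the loop does not terminate, i.e. if every block read is
  rejected.\<close>

definition draw_below :: "nat \<Rightarrow> bool stream \<Rightarrow> nat option" where
  "draw_below P s =
     (let k = nat \<lceil>log 2 (real P)\<rceil>
      in map_option fst
           (while_option (\<lambda>(V, s). \<not> V < P) (\<lambda>(V, s). read_block k s) (read_block k s)))"

text \<open>\<open>foldr\<close> visits the bases from the last one to the first, as the extraction loop does.\<close>

definition mr_digits :: "nat list \<Rightarrow> nat \<Rightarrow> nat list" where
  "mr_digits bs V = snd (foldr (\<lambda>b (V, ks). (V div b, V mod b # ks)) bs (V, []))"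

definition extract_key :: "nat list \<Rightarrow> bool stream \<Rightarrow> nat list option" where
  "extract_key bs s = map_option (mr_digits bs) (draw_below (prod_list bs) s)"

definition mr_otp_encrypt :: "nat list \<Rightarrow> nat list \<Rightarrow> nat list \<Rightarrow> nat list" where
  "mr_otp_encrypt bs m K = map (\<lambda>i. (m ! i + K ! i) mod (bs ! i)) [0..<length bs]"

definition perfect_secrecy :: "'a measure \<Rightarrow> ('a \<Rightarrow> 'm) \<Rightarrow> ('a \<Rightarrow> 'c) \<Rightarrow> bool" where
  "perfect_secrecy \<Omega> M C \<longleftrightarrow>
     (\<forall>c. \<P>(\<omega> in \<Omega>. C \<omega> = c) > 0 \<longrightarrow>
       (\<forall>m. \<P>(\<omega> in \<Omega>. M \<omega> = m \<bar> C \<omega> = c) = \<P>(\<omega> in \<Omega>. M \<omega> = m)))"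

end

theory Submission imports Defs begin

text \<open>The event that the extraction loop stops with value \<open>V\<close> after \<open>n\<close> rejected blocks is the
  disjoint union of cylinders, one for each sequence of \<open>n\<close> rejected blocks, all of them completed
  by the binary expansion of \<open>V\<close>. All cylinders of a given length have the same probability, so
  the probability of this event does not depend on \<open>V\<close>, and neither does its sum over \<open>n\<close>. As
  mixed-radix expansion is a bijection, the key is equally likely to take any two values. For each
  message, every ciphertext arises from exactly one key; hence the joint probability of \<open>m\<close> and
  \<open>c\<close> is \<open>Pr[M = m]\<close> times a factor that depends on \<open>c\<close> only. Nontermination (the ciphertext
  \<open>None\<close>) is a property of the source alone and hence independent of the message.\<close>

section \<open>Mixed-radix digits and encryption\<close>

lemma mr_tuples_Nil: "mr_tuples [] = {[]}"
  by (auto simp: mr_tuples_def)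

lemma Cons_mem_mr_tuples: "x # xs \<in> mr_tuples (b # bs) \<longleftrightarrow> x < b \<and> xs \<in> mr_tuples bs"
  by (auto simp: mr_tuples_def nth_Cons' less_Suc_eq_0_disj)

lemma mem_mr_tuples_Cons:
  "ys \<in> mr_tuples (b # bs) \<longleftrightarrow> (\<exists>x xs. ys = x # xs \<and> x < b \<and> xs \<in> mr_tuples bs)"
  by (cases ys) (auto simp: Cons_mem_mr_tuples, auto simp: mr_tuples_def)

lemma finite_mr_tuples: "finite (mr_tuples bs)"
proof (induction bs)
  case (Cons b bs)
  have "mr_tuples (b # bs) = (\<lambda>(x, xs). x # xs) ` ({..<b} \<times> mr_tuples bs)"
    by (auto simp: mem_mr_tuples_Cons)
  with Cons show ?case by simp
qed (simp add: mr_tuples_Nil)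

text \<open>Successive floor divisions compose to one division by the product. This is the value
  that the next base on the left gets to see.\<close>

lemma fst_foldr_mr_digits:
  "fst (foldr (\<lambda>b (V, ks). (V div b, V mod b # ks)) bs (V, [])) = V div prod_list (bs :: nat list)"
  by (induction bs) (simp_all add: case_prod_beta div_mult2_eq mult.commute[of _ "prod_list _"])

lemma mr_digits_Nil: "mr_digits [] V = []"
  by (simp add: mr_digits_def)

lemma mr_digits_Cons: "mr_digits (b # bs) V = (V div prod_list bs) mod b # mr_digits bs V"
  by (simp add: mr_digits_def case_prod_beta fst_foldr_mr_digits)

lemma mr_digits_in_mr_tuples:
  assumes "0 \<notin> set bs"
  shows "mr_digits bs V \<in> mr_tuples bs"
  using assms by (induction bs) (auto simp: mr_tuples_Nil mr_digits_Nil mr_digits_Cons Cons_mem_mr_tuples)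

text \<open>A residue modulo \<open>b * P\<close> is the same data as the residue modulo
  \<open>P\<close> together with the digit \<open>V div P mod b\<close>. Residues rather than bounds
  on \<open>V\<close> suit the induction, since the tail digits are taken of the same unreduced
  \<open>V\<close>.\<close>

lemma mr_digits_eq_iff:
  assumes "0 \<notin> set bs"
  shows "mr_digits bs V = mr_digits bs W \<longleftrightarrow> V mod prod_list bs = W mod prod_list bs"
  using assms
proof (induction bs)
  case (Cons b bs)
  let ?P = "prod_list bs"
  have P: "?P > 0" using Cons.prems by (auto intro!: Nat.gr0I simp: prod_list_zero_iff)
  have eq: "X mod (b * ?P) = X mod ?P + ?P * (X div ?P mod b)" for X
    using mod_mult2_eq[of X ?P b] by (simp only: mult.commute[of b] add.commute)
  have "X mod (b * ?P) mod ?P = X mod ?P" "X mod (b * ?P) div ?P = X div ?P mod b" for X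
    using P by (simp_all add: eq)
  then have "V mod (b * ?P) = W mod (b * ?P) \<longleftrightarrow>
      V mod ?P = W mod ?P \<and> V div ?P mod b = W div ?P mod b"
    by (metis eq)
  with Cons show ?case by (auto simp: mr_digits_Cons)
qed (simp add: mr_digits_Nil)

text \<open>The preimage is built as \<open>x * P + W\<close>: adding a multiple of \<open>P\<close>
  preserves the tail digits of \<open>W\<close>, and \<open>W < P\<close> makes the quotient exactly
  \<open>x\<close>.\<close>

lemma mr_digits_surj:
  assumes "0 \<notin> set bs" "K \<in> mr_tuples bs"
  shows "\<exists>V < prod_list bs. mr_digits bs V = K"
  using assms
proof (induction bs arbitrary: K)
  case (Cons b bs)
  let ?P = "prod_list bs"
  have P: "?P > 0" using Cons.prems by (auto intro!: Nat.gr0I simp: prod_list_zero_iff)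
  obtain x xs where K: "K = x # xs" "x < b" "xs \<in> mr_tuples bs"
    using Cons.prems by (auto simp: mem_mr_tuples_Cons)
  obtain W where W: "W < ?P" "mr_digits bs W = xs" using Cons K by auto
  have "mr_digits bs (x * ?P + W) = mr_digits bs W"
    using Cons.prems by (subst mr_digits_eq_iff) auto
  then have "mr_digits (b # bs) (x * ?P + W) = K"
    using W K P by (simp add: mr_digits_Cons)
  moreover have "x * ?P + W < Suc x * ?P" using W by simp
  then have "x * ?P + W < b * ?P" using K(2)
    by (meson Suc_leI less_le_trans mult_le_mono1)
  ultimately show ?case by auto
qed (auto simp: mr_tuples_Nil mr_digits_Nil)

section \<open>Digitwise modular encryption and decryption\<close>

lemma map_mod_in_mr_tuples:
  assumes "0 \<notin> set bs"
  shows "map (\<lambda>i. f i mod bs ! i) [0..<length bs] \<in> mr_tuples bs"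
proof -
  have "0 < bs ! i" if "i < length bs" for i
    using assms nth_mem[OF that] by (metis gr0I)
  then show ?thesis by (simp add: mr_tuples_def)
qed

lemma mr_otp_encrypt_in_mr_tuples:
  assumes "0 \<notin> set bs"
  shows "mr_otp_encrypt bs m K \<in> mr_tuples bs"
  unfolding mr_otp_encrypt_def by (rule map_mod_in_mr_tuples[OF assms])

text \<open>Subtraction of \<open>m\<close> modulo \<open>b\<close> is written as addition of
  \<open>b - m\<close>, because subtraction on naturals truncates.\<close>

lemma mod_add_eq_iff_nat:
  fixes m k c b :: nat
  assumes "m < b" "k < b" "c < b"
  shows "(m + k) mod b = c \<longleftrightarrow> k = (c + (b - m)) mod b"
proof
  assume "(m + k) mod b = c"
  then have "(c + (b - m)) mod b = (m + k + (b - m)) mod b" by (metis mod_add_left_eq)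
  also have "m + k + (b - m) = k + b" using assms by simp
  finally show "k = (c + (b - m)) mod b" using assms by simp
next
  assume "k = (c + (b - m)) mod b"
  then have "(m + k) mod b = (m + (c + (b - m))) mod b" by (metis mod_add_right_eq)
  also have "m + (c + (b - m)) = c + b" using assms by simp
  finally show "(m + k) mod b = c" using assms by simp
qed

definition mr_otp_decrypt :: "nat list \<Rightarrow> nat list \<Rightarrow> nat list \<Rightarrow> nat list" where
  "mr_otp_decrypt bs K c = map (\<lambda>i. (c ! i + (bs ! i - K ! i)) mod (bs ! i)) [0..<length bs]"

lemma mr_otp_decrypt_in_mr_tuples:
  assumes "0 \<notin> set bs"
  shows "mr_otp_decrypt bs K c \<in> mr_tuples bs"
  unfolding mr_otp_decrypt_def by (rule map_mod_in_mr_tuples[OF assms])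

text \<open>Encryption is symmetric in message and key, so decrypting with the message yields the key.\<close>

lemma mr_otp_encrypt_eq_iff:
  assumes "m \<in> mr_tuples bs" "K \<in> mr_tuples bs" "c \<in> mr_tuples bs"
  shows "mr_otp_encrypt bs m K = c \<longleftrightarrow> K = mr_otp_decrypt bs m c"
proof -
  have len: "length K = length bs" "length c = length bs"
    using assms by (simp_all add: mr_tuples_def)
  have lt: "m ! i < bs ! i" "K ! i < bs ! i" "c ! i < bs ! i" if "i < length bs" for i
    using assms that unfolding mr_tuples_def by blast+
  have enc: "length (mr_otp_encrypt bs m K) = length bs"
    "i < length bs \<Longrightarrow> mr_otp_encrypt bs m K ! i = (m ! i + K ! i) mod (bs ! i)" for i
    by (simp_all add: mr_otp_encrypt_def)
  have dec: "length (mr_otp_decrypt bs m c) = length bs"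
    "i < length bs \<Longrightarrow> mr_otp_decrypt bs m c ! i = (c ! i + (bs ! i - m ! i)) mod (bs ! i)" for i
    by (simp_all add: mr_otp_decrypt_def)
  have "mr_otp_encrypt bs m K = c \<longleftrightarrow> (\<forall>i<length bs. (m ! i + K ! i) mod (bs ! i) = c ! i)"
    by (metis (no_types, lifting) enc len(2) nth_equalityI)
  also have "\<dots> \<longleftrightarrow> (\<forall>i<length bs. K ! i = (c ! i + (bs ! i - m ! i)) mod (bs ! i))"
    using mod_add_eq_iff_nat[OF lt] by blast
  also have "\<dots> \<longleftrightarrow> K = mr_otp_decrypt bs m c"
    by (metis (no_types, lifting) dec len(1) nth_equalityI)
  finally show ?thesis .
qed

section \<open>The rejection loop\<close>

lemma horner_sum_of_bool_2_inj:
  assumes "length xs = length ys"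
    and "horner_sum of_bool 2 xs = (horner_sum of_bool 2 ys :: nat)"
  shows "xs = ys"
  using assms
proof (induction xs ys rule: list_induct2)
  case (Cons x xs y ys)
  then have "of_bool x + 2 * horner_sum of_bool 2 xs = of_bool y + (2 * horner_sum of_bool 2 ys :: nat)"
    by simp
  \<comment> \<open>Comparing parities isolates the lowest bit.\<close>
  moreover from this have "even (of_bool x + 2 * horner_sum of_bool 2 xs :: nat)
      \<longleftrightarrow> even (of_bool y + 2 * horner_sum of_bool 2 ys :: nat)" by (simp only:)
  then have "x = y" by auto
  ultimately show ?case using Cons.IH by simp
qed simp

text \<open>Indexing blocks from 0 directly in the stream replaces the stream remainder that the
  loop threads through.\<close>

definition block :: "nat \<Rightarrow> bool stream \<Rightarrow> nat \<Rightarrow> nat" where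
  "block k s j = horner_sum of_bool 2 (rev (stake k (sdrop (j * k) s)))"

text \<open>A number below \<open>2 ^ k\<close> has exactly one \<open>k\<close>-bit expansion, so
  the event is a cylinder. The reversal puts the most significant bit first.\<close>

lemma block_eq_iff:
  assumes "v < 2 ^ k"
  shows "block k s j = v \<longleftrightarrow> stake k (sdrop (j * k) s) = rev (map (bit v) [0..<k])"
proof -
  have v: "horner_sum of_bool 2 (map (bit v) [0..<k]) = v"
    using assms by (simp only: horner_sum_bit_eq_take_bit take_bit_nat_eq_self)
  show ?thesis
    using horner_sum_of_bool_2_inj[of "rev (stake k (sdrop (j * k) s))" "map (bit v) [0..<k]"] v
    by (auto simp: block_def simp flip: rev_swap)
qed

lemma block_cong:
  assumes "stake (n * k) s = stake (n * k) t" "j < n"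
  shows "block k s j = block k t j"
proof -
  have "Suc j * k \<le> n * k" using assms(2) by (intro mult_le_mono1) simp
  then have le: "k \<le> n * k - j * k" by simp
  have "stake k (sdrop (j * k) u) = take k (drop (j * k) (stake (n * k) u))" for u :: "bool stream"
    using le by (simp add: drop_stake take_stake min_absorb1)
  with assms(1) show ?thesis by (simp add: block_def)
qed

text \<open>One block is read before the loop starts, so after \<open>j\<close> iterations
  \<open>Suc j\<close> blocks are consumed and block \<open>j\<close> is current.\<close>

lemma funpow_read_block:
  "((\<lambda>(V, s). read_block k s) ^^ j) (read_block k s) = (block k s j, sdrop (Suc j * k) s)"
  by (induction j) (auto simp: read_block_def block_def add.commute)

lemma draw_below_eq:
  defines "k \<equiv> \<lambda>P. nat \<lceil>log 2 (real P)\<rceil>"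
  shows "draw_below P s =
    (if \<exists>j. block (k P) s j < P
     then Some (block (k P) s (LEAST j. block (k P) s j < P)) else None)"
  by (simp add: draw_below_def while_option_def funpow_read_block k_def case_prod_beta Let_def)

lemma draw_below_eq_None_iff:
  "draw_below P s = None \<longleftrightarrow> (\<forall>j. P \<le> block (nat \<lceil>log 2 (real P)\<rceil>) s j)"
  by (simp add: draw_below_eq flip: not_less)

text \<open>The least accepted index is the only one preceded by rejections alone. The existential
  form splits the event by the number of rejected blocks, as measurability and the probability
  series require.\<close>

lemma draw_below_eq_Some_iff:
  "draw_below P s = Some v \<longleftrightarrow> v < P \<and>
     (\<exists>n. (\<forall>j<n. P \<le> block (nat \<lceil>log 2 (real P)\<rceil>) s j) \<and>
          block (nat \<lceil>log 2 (real P)\<rceil>) s n = v)"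
proof -
  define f where "f = block (nat \<lceil>log 2 (real P)\<rceil>) s"
  have "f (LEAST j. f j < P) = v \<and> v < P"
    if "v < P" "\<forall>j<n. P \<le> f j" "f n = v" for n
  proof -
    have "(LEAST j. f j < P) = n"
      using that by (intro Least_equality) (auto simp flip: not_le)
    with that show ?thesis by simp
  qed
  moreover have "f (LEAST j. f j < P) < P" "\<forall>i<LEAST j. f j < P. P \<le> f i"
    if "f j < P" for j
    using that by (auto intro: LeastI dest: not_less_Least simp: not_less)
  ultimately show ?thesis
    unfolding draw_below_eq f_def[symmetric] by (auto split: if_splits) blast+
qed

text \<open>Ensures that every value below \<open>P\<close> occurs as a \<open>k\<close>-bit
  block.\<close>

lemma le_two_power_ceiling_log:
  assumes "P > 0"
  shows "P \<le> 2 ^ nat \<lceil>log 2 (real P)\<rceil>"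
proof -
  have "real P = 2 powr log 2 (real P)" using assms by simp
  also have "\<dots> \<le> 2 powr real (nat \<lceil>log 2 (real P)\<rceil>)"
    by (intro powr_mono) linarith+
  also have "\<dots> = real (2 ^ nat \<lceil>log 2 (real P)\<rceil>)" by (simp add: powr_realpow)
  finally show ?thesis by (simp only: of_nat_le_iff)
qed

section \<open>Measurability and values of the extracted key\<close>

lemma measurable_block [measurable]:
  "(\<lambda>s. block k s j) \<in> stream_space (count_space UNIV) \<rightarrow>\<^sub>M count_space UNIV"
proof -
  have "(\<lambda>xs. horner_sum of_bool 2 (rev xs) :: nat) \<in> count_space UNIV \<rightarrow>\<^sub>M count_space UNIV"
    by simp
  then show ?thesis unfolding block_def by measurable
qed

lemma measurable_draw_below [measurable]:
  "draw_below P \<in> stream_space (count_space UNIV) \<rightarrow>\<^sub>M count_space UNIV"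
\<comment> \<open>The target is countable, so singletons suffice; their preimages are countable
  combinations of events about single blocks.\<close>
proof (rule measurable_count_space_eq2_countable[THEN iffD2], intro conjI ballI)
  fix d :: "nat option"
  have "Measurable.pred (stream_space (count_space UNIV)) (\<lambda>s. draw_below P s = d)"
    by (cases d) (simp_all add: draw_below_eq_None_iff draw_below_eq_Some_iff)
  then show "draw_below P -` {d} \<inter> space (stream_space (count_space UNIV))
      \<in> sets (stream_space (count_space UNIV))"
    by (simp add: pred_def vimage_def Int_def conj_commute)
qed auto

lemma measurable_extract_key [measurable]:
  "extract_key bs \<in> stream_space (count_space UNIV) \<rightarrow>\<^sub>M count_space UNIV"
  unfolding extract_key_def by measurable

lemma extract_key_in_mr_tuples:
  assumes "0 \<notin> set bs" "extract_key bs s = Some K"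
  shows "K \<in> mr_tuples bs"
  using assms by (auto simp: extract_key_def mr_digits_in_mr_tuples)

text \<open>Drawn values lie below the product, where the digit map is injective; uniformity thus
  passes from the drawn value to the key.\<close>

lemma extract_key_eq_Some_iff:
  assumes "0 \<notin> set bs" "V < prod_list bs"
  shows "extract_key bs s = Some (mr_digits bs V) \<longleftrightarrow> draw_below (prod_list bs) s = Some V"
proof -
  have "W = V" if "draw_below (prod_list bs) s = Some W" "mr_digits bs W = mr_digits bs V" for W
    using that assms by (auto simp: mr_digits_eq_iff draw_below_eq_Some_iff)
  then show ?thesis by (auto simp: extract_key_def)
qed

section \<open>Uniformity of the key\<close>

context prob_space
begin

lemma prob_stake_eq:
  assumes S: "ideal_source M S" and [measurable]: "S \<in> M \<rightarrow>\<^sub>M stream_space (count_space UNIV)"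
  shows "\<P>(\<omega> in M. stake (length xs) (S \<omega>) = xs) = 1 / 2 ^ length xs"
\<comment> \<open>An intersection over no indices would be \<open>UNIV\<close> instead of
  \<open>space M\<close>, so the empty prefix is treated separately.\<close>
proof (cases "xs = []")
  case True
  then show ?thesis by (simp add: prob_space)
next
  case False
  have bit: "prob ((\<lambda>\<omega>. S \<omega> !! n) -` {b} \<inter> space M) = 1 / 2" for n b
  proof -
    have "prob ((\<lambda>\<omega>. S \<omega> !! n) -` {b} \<inter> space M)
        = measure (distr M (count_space UNIV) (\<lambda>\<omega>. S \<omega> !! n)) {b}"
      by (subst measure_distr) auto
    also have "\<dots> = measure (uniform_count_measure UNIV) {b}"
      using S by (simp add: ideal_source_def)
    also have "\<dots> = 1 / 2" by (simp add: measure_uniform_count_measure)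
    finally show ?thesis .
  qed
  have "stake (length xs) s = xs \<longleftrightarrow> (\<forall>i<length xs. s !! i = xs ! i)" for s
  proof
    assume eq: "stake (length xs) s = xs"
    show "\<forall>i<length xs. s !! i = xs ! i"
      using stake_nth[of _ "length xs" s] unfolding eq by simp
  next
    assume "\<forall>i<length xs. s !! i = xs ! i"
    then show "stake (length xs) s = xs" by (intro nth_equalityI) simp_all
  qed
  then have "{\<omega> \<in> space M. stake (length xs) (S \<omega>) = xs}
      = (\<Inter>i\<in>{..<length xs}. (\<lambda>\<omega>. S \<omega> !! i) -` {xs ! i} \<inter> space M)"
    using False by auto
  also have "prob \<dots> = (\<Prod>i\<in>{..<length xs}. prob ((\<lambda>\<omega>. S \<omega> !! i) -` {xs ! i} \<inter> space M))"
    using S False unfolding ideal_source_def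
    by (intro indep_varsD[where I = UNIV and M' = "\<lambda>_. count_space UNIV"]) auto
  also have "\<dots> = 1 / 2 ^ length xs" by (simp add: bit power_one_over)
  finally show ?thesis .
qed

text \<open>The event is the disjoint union of the cylinders of \<open>xs @ ys\<close> for
  \<open>xs\<close> in \<open>R\<close>. Its probability depends on \<open>ys\<close> only through
  the length, which is the source of uniformity.\<close>

lemma prob_stake_mem_and_next_eq:
  assumes S: "ideal_source M S" and [measurable]: "S \<in> M \<rightarrow>\<^sub>M stream_space (count_space UNIV)"
    and R: "\<And>xs. xs \<in> R \<Longrightarrow> length xs = N"
  shows "\<P>(\<omega> in M. stake N (S \<omega>) \<in> R \<and> stake (length ys) (sdrop N (S \<omega>)) = ys)
    = card R / 2 ^ (N + length ys)"
proof -
  have fin: "finite R"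
    using R by (intro finite_subset[OF _ finite_lists_length_eq[of "UNIV :: bool set" N]]) auto
  let ?C = "\<lambda>zs. {\<omega> \<in> space M. stake (length zs) (S \<omega>) = zs}"
  have meas: "?C zs \<in> events" for zs by measurable
  have "{\<omega> \<in> space M. stake N (S \<omega>) \<in> R \<and> stake (length ys) (sdrop N (S \<omega>)) = ys}
      = (\<Union>xs\<in>R. ?C (xs @ ys))"
    using R by (auto simp flip: stake_add simp: append_eq_append_conv)
  also have "prob \<dots> = (\<Sum>xs\<in>R. prob (?C (xs @ ys)))"
    using fin meas R by (intro finite_measure_finite_Union) (auto simp: disjoint_family_on_def)
  also have "\<dots> = (\<Sum>xs\<in>R. 1 / 2 ^ (N + length ys))"
    using prob_stake_eq[OF assms(1,2), of "_ @ ys"] R by (intro sum.cong) auto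
  finally show ?thesis by simp
qed

lemma prob_draw_below_uniform:
  assumes S: "ideal_source M S" and [measurable]: "S \<in> M \<rightarrow>\<^sub>M stream_space (count_space UNIV)"
    and "v < P" "w < P"
  shows "\<P>(\<omega> in M. draw_below P (S \<omega>) = Some v) = \<P>(\<omega> in M. draw_below P (S \<omega>) = Some w)"
proof -
  define k where "k = nat \<lceil>log 2 (real P)\<rceil>"
  define E where "E u n = {\<omega> \<in> space M. (\<forall>j<n. P \<le> block k (S \<omega>) j) \<and> block k (S \<omega>) n = u}" for u n
  \<comment> \<open>The prefixes formed by \<open>n\<close> rejected blocks; they do not involve the
    accepted value \<open>u\<close>.\<close>
  define R where "R n = stake (n * k) ` {s. \<forall>j<n. P \<le> block k s j}" for n
  have E: "prob (E u n) = card (R n) / 2 ^ (n * k + k)" if "u < P" for u n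
  proof -
    define ys where "ys = rev (map (bit u) [0..<k])"
    have [simp]: "length ys = k" by (simp add: ys_def)
    have "u < 2 ^ k" using that le_two_power_ceiling_log[of P] by (simp add: k_def)
    \<comment> \<open>Whether the first \<open>n\<close> blocks are rejected is decided by the first
      \<open>n * k\<close> bits.\<close>
    moreover have "stake (n * k) s \<in> R n \<longleftrightarrow> (\<forall>j<n. P \<le> block k s j)" for s
      by (auto simp: R_def dest: block_cong)
    ultimately have "E u n = {\<omega> \<in> space M. stake (n * k) (S \<omega>) \<in> R n \<and>
        stake (length ys) (sdrop (n * k) (S \<omega>)) = ys}"
      by (simp add: E_def block_eq_iff ys_def)
    also have "prob \<dots> = card (R n) / 2 ^ (n * k + length ys)"
      by (rule prob_stake_mem_and_next_eq[OF assms(1,2)]) (auto simp: R_def)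
    finally show ?thesis by simp
  qed
  have sums: "(\<lambda>n. card (R n) / 2 ^ (n * k + k)) sums \<P>(\<omega> in M. draw_below P (S \<omega>) = Some u)"
    if "u < P" for u
  proof -
    have meas: "E u n \<in> events" for n unfolding E_def by measurable
    \<comment> \<open>Block \<open>n\<close> equals \<open>u < P\<close> in the first event but is
      rejected in the second.\<close>
    have "E u n \<inter> E u n' = {}" if "n < n'" for n n'
      using that \<open>u < P\<close> by (auto simp: E_def)
    then have "disjoint_family (E u)"
      unfolding disjoint_family_on_def by (metis Int_commute linorder_neqE_nat)
    then have "(\<lambda>n. prob (E u n)) sums prob (\<Union>n. E u n)"
      using meas by (intro finite_measure_UNION) auto
    moreover have "(\<Union>n. E u n) = {\<omega> \<in> space M. draw_below P (S \<omega>) = Some u}"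
      using that by (auto simp: E_def draw_below_eq_Some_iff k_def)
    ultimately show ?thesis using that by (simp add: E)
  qed
  \<comment> \<open>Both probabilities are sums of the same series, which need not be
    evaluated.\<close>
  show ?thesis using sums[OF assms(3)] sums[OF assms(4)] by (rule sums_unique2)
qed

lemma prob_extract_key_uniform:
  assumes "0 \<notin> set bs"
    and "ideal_source M S" "S \<in> M \<rightarrow>\<^sub>M stream_space (count_space UNIV)"
    and "K \<in> mr_tuples bs" "K' \<in> mr_tuples bs"
  shows "\<P>(\<omega> in M. extract_key bs (S \<omega>) = Some K) = \<P>(\<omega> in M. extract_key bs (S \<omega>) = Some K')"
proof -
  obtain V V' where V: "V < prod_list bs" "V' < prod_list bs"
    and K: "mr_digits bs V = K" "mr_digits bs V' = K'"
    using mr_digits_surj assms(1,4,5) by meson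
  from prob_draw_below_uniform[OF assms(2,3) V] show ?thesis
    by (simp only: extract_key_eq_Some_iff[OF assms(1)] V flip: K)
qed

section \<open>Perfect secrecy\<close>

lemma indep_rvsD:
  assumes "indep_rvs M N X N' Y" "A \<in> sets N" "B \<in> sets N'"
  shows "\<P>(\<omega> in M. X \<omega> \<in> A \<and> Y \<omega> \<in> B) = \<P>(\<omega> in M. X \<omega> \<in> A) * \<P>(\<omega> in M. Y \<omega> \<in> B)"
proof -
  have "prob ((X -` A \<inter> space M) \<inter> (Y -` B \<inter> space M))
      = prob (X -` A \<inter> space M) * prob (Y -` B \<inter> space M)"
    using assms unfolding indep_rvs_def by (intro indep_setD) (auto intro!: sigma_sets.Basic)
  moreover have "(X -` A \<inter> space M) \<inter> (Y -` B \<inter> space M) = {\<omega> \<in> space M. X \<omega> \<in> A \<and> Y \<omega> \<in> B}"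
    "X -` A \<inter> space M = {\<omega> \<in> space M. X \<omega> \<in> A}" "Y -` B \<inter> space M = {\<omega> \<in> space M. Y \<omega> \<in> B}"
    by auto
  ultimately show ?thesis by simp
qed

text \<open>Factorisation criterion: summing the joint probabilities over all messages identifies
  the message-independent factor \<open>q\<close> as the probability of the ciphertext, and dividing
  by it leaves the prior.\<close>

lemma perfect_secrecyI:
  assumes "finite T" and X: "X \<in> M \<rightarrow>\<^sub>M count_space T"
    and meas: "\<And>m c. m \<in> T \<Longrightarrow> {\<omega> \<in> space M. X \<omega> = m \<and> C \<omega> = c} \<in> events"
    and joint: "\<And>c. \<exists>q. \<forall>m\<in>T. \<P>(\<omega> in M. X \<omega> = m \<and> C \<omega> = c) = \<P>(\<omega> in M. X \<omega> = m) * q"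
  shows "perfect_secrecy M X C"
  unfolding perfect_secrecy_def
proof (intro allI impI)
  fix c m
  assume pos: "\<P>(\<omega> in M. C \<omega> = c) > 0"
  obtain q where q: "\<P>(\<omega> in M. X \<omega> = m \<and> C \<omega> = c) = \<P>(\<omega> in M. X \<omega> = m) * q" if "m \<in> T" for m
    using joint by meson
  have T: "X \<omega> \<in> T" if "\<omega> \<in> space M" for \<omega>
    using measurable_space[OF X that] by simp
  have X_meas: "{\<omega> \<in> space M. X \<omega> = m} \<in> events" if "m \<in> T" for m
    using measurable_sets[OF X, of "{m}"] that by (simp add: vimage_def Int_def conj_commute)
  have "{\<omega> \<in> space M. C \<omega> = c} = (\<Union>m\<in>T. {\<omega> \<in> space M. X \<omega> = m \<and> C \<omega> = c})"
    using T by auto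
  also have "prob \<dots> = (\<Sum>m\<in>T. \<P>(\<omega> in M. X \<omega> = m \<and> C \<omega> = c))"
    using assms(1) meas by (intro finite_measure_finite_Union) (auto simp: disjoint_family_on_def)
  also have "\<dots> = (\<Sum>m\<in>T. \<P>(\<omega> in M. X \<omega> = m)) * q"
    by (simp add: q sum_distrib_right)
  also have "(\<Sum>m\<in>T. \<P>(\<omega> in M. X \<omega> = m)) = prob (\<Union>m\<in>T. {\<omega> \<in> space M. X \<omega> = m})"
    using assms(1) X_meas by (intro finite_measure_finite_Union[symmetric]) (auto simp: disjoint_family_on_def)
  also have "(\<Union>m\<in>T. {\<omega> \<in> space M. X \<omega> = m}) = space M" using T by auto
  finally have C: "\<P>(\<omega> in M. C \<omega> = c) = q" by (simp add: prob_space)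
  show "\<P>(\<omega> in M. X \<omega> = m \<bar> C \<omega> = c) = \<P>(\<omega> in M. X \<omega> = m)"
  proof (cases "m \<in> T")
    case True
    then show ?thesis using pos by (simp add: cond_prob_def C q)
  next
    case False
    \<comment> \<open>Outside the message space both probabilities are 0.\<close>
    then have "{\<omega> \<in> space M. X \<omega> = m} = {}" "{\<omega> \<in> space M. X \<omega> = m \<and> C \<omega> = c} = {}"
      using T by auto
    then show ?thesis unfolding cond_prob_def by (simp only: measure_empty div_0)
  qed
qed

lemma perfect_secrecy_mr_otp:
  assumes bs: "0 \<notin> set bs" and S: "ideal_source M S"
    and ind: "indep_rvs M (count_space (mr_tuples bs)) X (stream_space (count_space UNIV)) S"
  shows "perfect_secrecy M X (\<lambda>\<omega>. map_option (mr_otp_encrypt bs (X \<omega>)) (extract_key bs (S \<omega>)))"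
    (is "perfect_secrecy M X ?C")
proof (rule perfect_secrecyI[OF finite_mr_tuples])
  let ?T = "mr_tuples bs"
  let ?Q = "\<lambda>d. \<P>(\<omega> in M. extract_key bs (S \<omega>) = d)"
  show X: "X \<in> M \<rightarrow>\<^sub>M count_space ?T" using ind by (simp add: indep_rvs_def)
  have S_meas [measurable]: "S \<in> M \<rightarrow>\<^sub>M stream_space (count_space UNIV)"
    using ind by (simp add: indep_rvs_def)
  have ind_key: "\<P>(\<omega> in M. X \<omega> = m \<and> extract_key bs (S \<omega>) = d) = \<P>(\<omega> in M. X \<omega> = m) * ?Q d"
    if "m \<in> ?T" for m d
  proof -
    \<comment> \<open>The key is a measurable function of the stream, so it inherits independence
      from the message.\<close>
    have "{s. extract_key bs s = d} \<in> sets (stream_space (count_space UNIV))"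
      using measurable_sets[OF measurable_extract_key, of "{d}" bs]
      by (simp add: vimage_def space_stream_space)
    from indep_rvsD[OF ind _ this, of "{m}"] that show ?thesis by simp
  qed
  show "{\<omega> \<in> space M. X \<omega> = m \<and> ?C \<omega> = c} \<in> events" if "m \<in> ?T" for m c
  proof -
    have "X -` {m} \<inter> space M \<in> events"
      using X that by (intro measurable_sets) auto
    \<comment> \<open>With the message fixed to \<open>m\<close>, the ciphertext is a measurable
      function of the stream alone.\<close>
    moreover have "{\<omega> \<in> space M. map_option (mr_otp_encrypt bs m) (extract_key bs (S \<omega>)) = c} \<in> events"
      by measurable
    moreover have "{\<omega> \<in> space M. X \<omega> = m \<and> ?C \<omega> = c}
        = (X -` {m} \<inter> space M) \<inter> {\<omega> \<in> space M. map_option (mr_otp_encrypt bs m) (extract_key bs (S \<omega>)) = c}"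
      by auto
    ultimately show ?thesis by simp
  qed
  show "\<exists>q. \<forall>m\<in>?T. \<P>(\<omega> in M. X \<omega> = m \<and> ?C \<omega> = c) = \<P>(\<omega> in M. X \<omega> = m) * q" for c
  proof (cases c)
    case None
    \<comment> \<open>The factor is the probability that extraction does not terminate.\<close>
    then show ?thesis using ind_key[of _ None] by auto
  next
    case (Some c')
    show ?thesis
    proof (cases "c' \<in> ?T")
      case False
      then have "{\<omega> \<in> space M. X \<omega> = m \<and> ?C \<omega> = c} = {}" for m
        using mr_otp_encrypt_in_mr_tuples[OF bs] Some by auto
      \<comment> \<open>Such a ciphertext never occurs, hence the factor 0.\<close>
      then show ?thesis by (intro exI[of _ 0]) (simp del: Collect_empty_eq)
    next
      case True
      show ?thesis
      proof (intro exI ballI)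
        fix m assume m: "m \<in> ?T"
        define K where "K = mr_otp_decrypt bs m c'"
        have K: "K \<in> ?T" "\<And>K'. K' \<in> ?T \<Longrightarrow> mr_otp_encrypt bs m K' = c' \<longleftrightarrow> K' = K"
          using mr_otp_decrypt_in_mr_tuples[OF bs] mr_otp_encrypt_eq_iff m True
          by (auto simp: K_def)
        have "{\<omega> \<in> space M. X \<omega> = m \<and> ?C \<omega> = c} =
            {\<omega> \<in> space M. X \<omega> = m \<and> extract_key bs (S \<omega>) = Some K}"
          using K extract_key_in_mr_tuples[OF bs] by (auto simp: Some)
        also have "prob \<dots> = \<P>(\<omega> in M. X \<omega> = m) * ?Q (Some K)" using m by (rule ind_key)
        \<comment> \<open>The key \<open>K\<close> varies with \<open>m\<close>. Uniformity
          exchanges it for a fixed reference key, for which the tuple \<open>c'\<close> itself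
          serves, so the factor no longer depends on \<open>m\<close>.\<close>
        also have "?Q (Some K) = ?Q (Some c')"
          using prob_extract_key_uniform[OF bs S S_meas K(1) True] .
        finally show "\<P>(\<omega> in M. X \<omega> = m \<and> ?C \<omega> = c) = \<P>(\<omega> in M. X \<omega> = m) * ?Q (Some c')" .
      qed
    qed
  qed
qed

end

theorem theorem4p2:
  fixes \<Omega> :: "'a measure" and bs :: "nat list"
    and S :: "'a \<Rightarrow> bool stream" and M :: "'a \<Rightarrow> nat list"
  assumes "prob_space \<Omega>"
    and "\<forall>b\<in>set bs. 2 \<le> b"
    and "ideal_source \<Omega> S"
    and "indep_rvs \<Omega> (count_space (mr_tuples bs)) M (stream_space (count_space UNIV)) S"
  shows "perfect_secrecy \<Omega> M
           (\<lambda>\<omega>. map_option (mr_otp_encrypt bs (M \<omega>)) (extract_key bs (S \<omega>)))"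
  using assms by (intro prob_space.perfect_secrecy_mr_otp) auto

end
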